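(* Let $\Phi$ be a formula of MLSSPF with set of variables $\mathcal X_\Phi$, let $\mathcal M$ be a set-valued assignment defined on $\mathcal X_\Phi$, with Venn partition $\Sigma=\Sigma_{\mathcal X_\Phi}$, together with the colored transitive $\Sigma$-board $\mathcal G=(T,\mathcal F,\mathcal Q)$ (the canonical board of $\mathcal M$ and $\Phi$). Let $\widehat\Sigma$ be a partition and $\beta:\Sigma\to\widehat\Sigma$ a bijection such that $\widehat\Sigma$ imitates $(\Sigma,\mathcal G)$ upwards via $\beta$. Define $\mathcal M'(v)=\bigcup\beta[\Im_{\mathcal M}(v)]$ for $v\in\mathcal X_\Phi$, where $\Im_{\mathcal M}(v)\subseteq\Sigma$ is such that $\mathcal M(v)=\bigcup\Im_{\mathcal M}(v)$. Let $\Phi^-$ be $\Phi$ without the literals of the type $\mathit{Finite}(x)$ or $\neg\mathit{Finite}(x)$. Then, for every literal in $\Phi^-$ and for the literals of the type $\mathit{Finite}(x)$ in $\Phi$: (1) if the literal is satisfied by $\mathcal M$, then it is satisfied by $\mathcal M'$ too; (2) if the literal is satisfied by $\mathcal M'$ and does not involve the powerset operator $\wp$ or the construct $\{\cdot,\dots,\cdot\}$, then it is satisfied by $\mathcal M$ too.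
   Context: **Language.** An MLSSPF formula is a propositional combination of literals of the forms $v=w$, $v\ne w$, $v=\emptyset$, $v=u\cup w$, $v=u\cap w$, $v=u\setminus w$, $v\subseteq u$, $v\not\subseteq u$, $v\in w$, $v\notin w$, $v=\wp(w)$ (powerset), $v=\{w_0,\dots,w_H\}$, $\mathit{Finite}(v)$ and $\neg\mathit{Finite}(v)$, where $u,v,w,w_i$ are variables. An assignment maps each variable to a set; literals are interpreted in the obvious way, $\mathit{Finite}(v)$ meaning that the set assigned to $v$ has cardinality $<\aleph_0$. **Partitions.** A partition is a family $\Sigma$ of nonempty pairwise disjoint sets (its blocks). It is transitive if $\bigcup\Sigma$ is a transitive set. The Venn partition of a family $\mathcal H$ is the coarsest partition $\Sigma$ of $\bigcup\mathcal H$ such that for all $x\in\mathcal H$ and $p\in\Sigma$, $p\cap x\neq\emptyset$ implies $p\subseteq x$. $\Sigma_{\mathcal X_\Phi}$ is the Venn partition of $\{\mathcal M(v):v\in\mathcal X_\Phi\}$. For a set $X$, $\wp^*(X)=\{Y : Y\subseteq\bigcup X \text{ and } Y\cap z\ne\emptyset\text{ for all }z\in X\}$. For a function $\beta$ and a set $X$, $\beta[X]=\{\beta(x):x\in X\}$. **Boards.** A colored transitive $\Sigma$-board, for a finite transitive partition $\Sigma$ (blocks are identified with places; subsets of $\Sigma$ are called nodes), is a triple $(T,\mathcal F,\mathcal Q)$ where $T(A)=\{q\in\Sigma:\wp^*(A)\cap q\neq\emptyset\}$ for $A\subseteq\Sigma$, $\mathcal F\subseteq\Sigma$ is a designated set of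 (red) blocks, and $\mathcal Q$ is a designated set of nodes closed under taking subsets. In particular $\Sigma=\Sigma_{\mathcal X_\Phi}$ is here a transitive partition. The canonical board of $\mathcal M$ and $\Phi$ is the board on $\Sigma_{\mathcal X_\Phi}$ in which $\mathcal F$ is the union of all $\Im_{\mathcal M}(v)$ for which a literal $v=\{w_0,\dots,w_H\}$ or $\mathit{Finite}(v)$ occurs in $\Phi$, and $\mathcal Q$ is the smallest collection of nodes that is closed under taking subsets and contains $\Im_{\mathcal M}(u)$ for each literal $u=\wp(w)$ in $\Phi$. **Imitation.** A partition $\widehat\Sigma$ imitates $(\Sigma,\mathcal G)$ upwards via a bijection $\beta:\Sigma\to\widehat\Sigma$ if for all $\Gamma\subseteq\Sigma$ and $\sigma\in\Sigma$: - (1) $\beta(\sigma)\cap\wp^*(\beta[\Gamma])\ne\emptyset$ iff $\sigma\cap\wp^*(\Gamma)\neq\emptyset$; - (2) $\bigcup\beta[\Gamma]\in\beta(\sigma)$ iff $\bigcup\Gamma\in\sigma$; - (3) if $\Gamma\in\mathcal Q$ then $\wp^*(\beta[\Gamma])\subseteq\bigcup\widehat\Sigma$; - (4) if $\sigma\in\mathcal F$ then $|\beta(\sigma)|<\aleph_0$; - (4') if $\sigma\in\mathcal F$ then $|\beta(\sigma)|=|\sigma|$.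
   Formalization: The designated nodes Q are generated by the nodes of the arguments w of literals u = ℘(w), not of the values u, and the partition Σ̂ is assumed transitive when Φ contains a powerset literal; without these changes claim (1) fails for u = ℘(w). *)

theory Defs
  imports "HOL-Library.Disjoint_Sets" "HOL-Library.Equipollence" "HOL-Library.Nat_Bijection"
begin

section \<open>The universe of sets\<close>

text \<open>The universe of sets is a type satisfying the axioms of Zermelo-Fraenkel set theory in
  second-order form, foundation being stated for classes. Infinity is deliberately left out:
  every universe of ZF(C) is an instance, and so are the hereditarily finite sets, which makes
  the axioms satisfiable provably in HOL (the instance \<open>nat\<close> below).
  Individual sets are elements of the universe; families of sets are HOL sets of such elements.\<close>

class set_universe =
  fixes elts :: "'a \<Rightarrow> 'a set"
  assumes extensionality: "elts x = elts y \<Longrightarrow> x = y"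
    and foundation: "S \<noteq> {} \<Longrightarrow> \<exists>x\<in>S. elts x \<inter> S = {}"
    and separation: "\<exists>z. elts z = {y \<in> elts x. P y}"
    and replacement: "\<exists>z. elts z = f ` elts x"
    and pairing: "\<exists>z. elts z = {x, y}"
    and union: "\<exists>z. elts z = (\<Union>y\<in>elts x. elts y)"
    and powerset: "\<exists>z. elts z = {y. elts y \<subseteq> elts x}"

lemma set_decode_less: "i \<in> set_decode n \<Longrightarrow> i < n"
proof -
  assume "i \<in> set_decode n"
  hence "2 ^ i \<le> n"
    by (intro subset_decode_imp_le) (metis set_decode_inverse set_encode_inverse
        set_encode_insert set_encode_empty finite.emptyI empty_iff add.right_neutral
        singletonD subsetI finite.insertI)
  thus "i < n" using less_exp[of i] by linarith
qed

instantiation nat :: set_universe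
begin

definition elts_nat :: "nat \<Rightarrow> nat set" where "elts_nat = set_decode"

lemma ex_elts_nat: "finite X \<Longrightarrow> \<exists>z::nat. elts z = X"
  by (metis elts_nat_def set_encode_inverse)

instance
proof
  fix x y :: nat and S :: "nat set" and P and f :: "nat \<Rightarrow> nat"
  have fin: "finite (elts z)" for z :: nat by (simp add: elts_nat_def)
  show "elts x = elts y \<Longrightarrow> x = y"
    unfolding elts_nat_def by (metis set_decode_inverse)
  show "\<exists>x\<in>S. elts x \<inter> S = {}" if "S \<noteq> {}"
  proof
    show "(LEAST n. n \<in> S) \<in> S" using that by (metis LeastI ex_in_conv)
    show "elts (LEAST n. n \<in> S) \<inter> S = {}"
      unfolding elts_nat_def using not_less_Least set_decode_less by blast
  qed
  show "\<exists>z. elts z = {y \<in> elts x. P y}" by (rule ex_elts_nat) (simp add: fin)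
  show "\<exists>z. elts z = f ` elts x" by (rule ex_elts_nat) (simp add: fin)
  show "\<exists>z. elts z = {x, y}" by (rule ex_elts_nat) simp
  show "\<exists>z. elts z = (\<Union>y\<in>elts x. elts y)" by (rule ex_elts_nat) (simp add: fin)
  have "{y. elts y \<subseteq> elts x} \<subseteq> {..x}"
    by (auto simp: elts_nat_def intro: subset_decode_imp_le)
  thus "\<exists>z. elts z = {y. elts y \<subseteq> elts x}" by (intro ex_elts_nat) (rule finite_subset, auto)
qed

end

definition union_of :: "'a::set_universe set \<Rightarrow> 'a" where
  "union_of X = (THE z. elts z = (\<Union>x\<in>X. elts x))"

definition pow_star :: "'a::set_universe set \<Rightarrow> 'a set" where
  "pow_star X = {y. elts y \<subseteq> (\<Union>x\<in>X. elts x) \<and> (\<forall>x\<in>X. elts y \<inter> elts x \<noteq> {})}"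


section \<open>Formulas\<close>

datatype (discs_sels) (lit_vars: 'v) literal =
    Eq 'v 'v
  | NotEq 'v 'v
  | IsEmpty 'v
  | IsUnion 'v 'v 'v
  | IsInter 'v 'v 'v
  | IsDiff 'v 'v 'v
  | Subset 'v 'v
  | NotSubset 'v 'v
  | Mem 'v 'v
  | NotMem 'v 'v
  | IsPow 'v 'v
  | IsEnum 'v 'v "'v list"  \<comment> \<open>\<open>IsEnum v w\<^sub>0 [w\<^sub>1, \<dots>, w\<^sub>H]\<close>\<close>
  | IsFinite 'v
  | NotFinite 'v

datatype (literals: 'v) prop_formula =
    Lit 'v
  | Neg "'v prop_formula"
  | Conj "'v prop_formula" "'v prop_formula"
  | Disj "'v prop_formula" "'v prop_formula"
  | Imp "'v prop_formula" "'v prop_formula"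
  | Iff "'v prop_formula" "'v prop_formula"

type_synonym 'v mlsspf = "'v literal prop_formula"

definition vars :: "'v mlsspf \<Rightarrow> 'v set" where
  "vars \<Phi> = (\<Union>l\<in>literals \<Phi>. lit_vars l)"

text \<open>The literals of the formula with all finiteness literals (positive and negative)
  removed.\<close>

definition literals_minus :: "'v mlsspf \<Rightarrow> 'v literal set" where
  "literals_minus \<Phi> = {l \<in> literals \<Phi>. \<not> is_IsFinite l \<and> \<not> is_NotFinite l}"

fun sat :: "('v \<Rightarrow> 'a::set_universe) \<Rightarrow> 'v literal \<Rightarrow> bool" where
  "sat M (Eq v w) \<longleftrightarrow> M v = M w"
| "sat M (NotEq v w) \<longleftrightarrow> M v \<noteq> M w"
| "sat M (IsEmpty v) \<longleftrightarrow> elts (M v) = {}"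
| "sat M (IsUnion v u w) \<longleftrightarrow> elts (M v) = elts (M u) \<union> elts (M w)"
| "sat M (IsInter v u w) \<longleftrightarrow> elts (M v) = elts (M u) \<inter> elts (M w)"
| "sat M (IsDiff v u w) \<longleftrightarrow> elts (M v) = elts (M u) - elts (M w)"
| "sat M (Subset v u) \<longleftrightarrow> elts (M v) \<subseteq> elts (M u)"
| "sat M (NotSubset v u) \<longleftrightarrow> \<not> elts (M v) \<subseteq> elts (M u)"
| "sat M (Mem v w) \<longleftrightarrow> M v \<in> elts (M w)"
| "sat M (NotMem v w) \<longleftrightarrow> M v \<notin> elts (M w)"
| "sat M (IsPow v w) \<longleftrightarrow> elts (M v) = {y. elts y \<subseteq> elts (M w)}"
| "sat M (IsEnum v w ws) \<longleftrightarrow> elts (M v) = M ` set (w # ws)"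
| "sat M (IsFinite v) \<longleftrightarrow> finite (elts (M v))"
| "sat M (NotFinite v) \<longleftrightarrow> infinite (elts (M v))"


section \<open>Partitions\<close>

text \<open>By extensionality \<open>elts\<close> is injective, so \<open>\<Sigma>\<close> and \<open>elts ` \<Sigma>\<close> have the same blocks.\<close>

definition set_partition :: "'a::set_universe set \<Rightarrow> bool" where
  "set_partition \<Sigma> \<longleftrightarrow> partition_on (\<Union>p\<in>\<Sigma>. elts p) (elts ` \<Sigma>)"

definition transitive_family :: "'a::set_universe set \<Rightarrow> bool" where
  "transitive_family \<Sigma> \<longleftrightarrow> (\<forall>x \<in> (\<Union>p\<in>\<Sigma>. elts p). elts x \<subseteq> (\<Union>p\<in>\<Sigma>. elts p))"

definition adapted_partition :: "'a::set_universe set \<Rightarrow> 'a set \<Rightarrow> bool" where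
  "adapted_partition H \<Sigma> \<longleftrightarrow>
     partition_on (\<Union>x\<in>H. elts x) (elts ` \<Sigma>) \<and>
     (\<forall>x\<in>H. \<forall>p\<in>\<Sigma>. elts p \<inter> elts x \<noteq> {} \<longrightarrow> elts p \<subseteq> elts x)"

definition is_venn_partition :: "'a::set_universe set \<Rightarrow> 'a set \<Rightarrow> bool" where
  "is_venn_partition H \<Sigma> \<longleftrightarrow>
     adapted_partition H \<Sigma> \<and>
     (\<forall>\<Sigma>'. adapted_partition H \<Sigma>' \<longrightarrow> refines (\<Union>x\<in>H. elts x) (elts ` \<Sigma>') (elts ` \<Sigma>))"

text \<open>The set of blocks whose union is \<open>x\<close>; for a variable \<open>v\<close> and an assignment \<open>M\<close>,
  \<open>parts \<Sigma> (M v)\<close> is the node usually written with a fraktur I.\<close>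

definition parts :: "'a::set_universe set \<Rightarrow> 'a \<Rightarrow> 'a set" where
  "parts \<Sigma> x = (THE \<Gamma>. \<Gamma> \<subseteq> \<Sigma> \<and> elts x = (\<Union>p\<in>\<Gamma>. elts p))"


section \<open>Boards and imitation\<close>

record 'a board =
  targets :: "'a set \<Rightarrow> 'a set"
  red :: "'a set"
  pnodes :: "'a set set"

definition board_targets :: "'a::set_universe set \<Rightarrow> 'a set \<Rightarrow> 'a set" where
  "board_targets \<Sigma> A = {q \<in> \<Sigma>. pow_star A \<inter> elts q \<noteq> {}}"

definition colored_transitive_board :: "'a::set_universe set \<Rightarrow> 'a board \<Rightarrow> bool" where
  "colored_transitive_board \<Sigma> G \<longleftrightarrow>
     finite \<Sigma> \<and> set_partition \<Sigma> \<and> transitive_family \<Sigma> \<and>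
     (\<forall>A \<subseteq> \<Sigma>. targets G A = board_targets \<Sigma> A) \<and>
     red G \<subseteq> \<Sigma> \<and>
     pnodes G \<subseteq> Pow \<Sigma> \<and> (\<forall>A \<in> pnodes G. \<forall>B \<subseteq> A. B \<in> pnodes G)"

text \<open>The designated nodes are generated by the arguments \<open>w\<close> of the powerset literals
  \<open>u = Pow(w)\<close>, not by their values \<open>u\<close>. For the assignment itself, \<open>pow_star \<Gamma>\<close> lies inside
  the set assigned to \<open>u\<close> precisely for the sets \<open>\<Gamma>\<close> of blocks contained in the set assigned
  to \<open>w\<close>. Generating the nodes from the values \<open>u\<close> would not enforce preservation of powerset
  literals.\<close>

definition canonical_board ::
  "('v \<Rightarrow> 'a::set_universe) \<Rightarrow> 'v mlsspf \<Rightarrow> 'a set \<Rightarrow> 'a board" where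
  "canonical_board M \<Phi> \<Sigma> =
     \<lparr> targets = board_targets \<Sigma>,
       red = \<Union> {parts \<Sigma> (M v) | v.
                  (\<exists>w ws. IsEnum v w ws \<in> literals \<Phi>) \<or> IsFinite v \<in> literals \<Phi>},
       pnodes = \<Inter> {Q. (\<forall>A \<in> Q. \<forall>B \<subseteq> A. B \<in> Q) \<and>
                       (\<forall>u w. IsPow u w \<in> literals \<Phi> \<longrightarrow> parts \<Sigma> (M w) \<in> Q)} \<rparr>"

text \<open>The fourth clause mentions only finiteness of the image block, the fifth equality of
  cardinalities. None of the clauses excludes elements of a block of \<open>\<Sigma>'\<close> that are not contained
  in the union of \<open>\<Sigma>'\<close>, so transitivity of \<open>\<Sigma>'\<close> is a separate condition.\<close>

definition imitates_upwards ::
  "'a::set_universe set \<Rightarrow> 'a board \<Rightarrow> 'a set \<Rightarrow> ('a \<Rightarrow> 'a) \<Rightarrow> bool" where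
  "imitates_upwards \<Sigma> G \<Sigma>' \<beta> \<longleftrightarrow>
     (\<forall>\<Gamma> \<sigma>. \<Gamma> \<subseteq> \<Sigma> \<longrightarrow> \<sigma> \<in> \<Sigma> \<longrightarrow>
        (elts (\<beta> \<sigma>) \<inter> pow_star (\<beta> ` \<Gamma>) \<noteq> {} \<longleftrightarrow> elts \<sigma> \<inter> pow_star \<Gamma> \<noteq> {}) \<and>
        (union_of (\<beta> ` \<Gamma>) \<in> elts (\<beta> \<sigma>) \<longleftrightarrow> union_of \<Gamma> \<in> elts \<sigma>) \<and>
        (\<Gamma> \<in> pnodes G \<longrightarrow> pow_star (\<beta> ` \<Gamma>) \<subseteq> (\<Union>p\<in>\<Sigma>'. elts p)) \<and>
        (\<sigma> \<in> red G \<longrightarrow> finite (elts (\<beta> \<sigma>))) \<and>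
        (\<sigma> \<in> red G \<longrightarrow> elts (\<beta> \<sigma>) \<approx> elts \<sigma>))"

end

theory Submission
  imports Defs
begin

text \<open>
  Over a partition \<open>\<Sigma>\<close> adapted to \<open>M\<close> each variable \<open>v\<close> is determined by its node, the set of blocks
  whose union is \<open>M v\<close>, and \<open>M' v\<close> is the union of the same node after each block \<open>\<sigma>\<close> is replaced by
  \<open>\<beta> \<sigma>\<close>. So both assignments are unions over one index set \<open>\<Sigma>\<close> of a disjoint family of nonempty
  sets, namely \<open>\<sigma> \<mapsto> \<sigma>\<close> and \<open>\<sigma> \<mapsto> \<beta> \<sigma>\<close>. For such families, inclusion, union, intersection and
  difference of unions are the same operations on nodes, which settles the Boolean literals in both
  directions (\<open>sat_boolean_iff\<close>).

  The other literals need the clauses of imitation. Membership is clause (2), because \<open>M v\<close> is the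
  union of its node (\<open>member_iff\<close>). On red nodes clause (4') makes \<open>M v\<close> and \<open>M' v\<close> equipollent,
  which settles finiteness; for an enumeration \<open>v = {w\<^sub>0, \<dots>, w\<^sub>H}\<close>, the sets \<open>M' w\<^sub>i\<close> are members of
  \<open>M' v\<close>, as many as the \<open>M w\<^sub>i\<close> because equality is transferred, and by equipollence they
  exhaust \<open>M' v\<close> (\<open>enumeration_transfer\<close>).

  For powersets (\<open>powerset_transfer\<close>), a set \<open>y\<close> covered by \<open>\<Sigma>'\<close> lies in \<open>pow_star (\<beta> ` \<Gamma>)\<close>, where
  \<open>\<beta> ` \<Gamma>\<close> consists of the blocks that \<open>y\<close> meets. If \<open>y\<close> is in a block \<open>\<beta> \<sigma>\<close>, clause (1) produces
  a member of \<open>\<sigma>\<close> in \<open>pow_star \<Gamma>\<close>. This witness compares \<open>\<sigma>\<close> with the powerset in \<open>M\<close>, whereas \<open>\<Gamma>\<close>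
  compares \<open>y\<close> with the base of the powerset. Clause (3) supplies the block containing \<open>y\<close> for one
  inclusion, and transitivity of \<open>\<Sigma>'\<close> ensures that \<open>y\<close> is covered for the other.
\<close>

section \<open>Finite families of sets in the universe\<close>

text \<open>The axioms give a union only for families that are sets themselves. Finite families are,
  but here the union is built directly, by repeated pairing and binary union.\<close>

lemma ex_elts_Union_finite:
  fixes X :: "'a::set_universe set"
  assumes "finite X"
  shows "\<exists>z. elts z = (\<Union>x\<in>X. elts x)"
  using assms
proof (induction X)
  case empty
  obtain z :: 'a where "elts z = {y \<in> elts undefined. False}"
    using separation[of undefined "\<lambda>_. False"] by blast
  then show ?case by (intro exI[of _ z]) simp
next
  case (insert x X)
  then obtain y where y: "elts y = (\<Union>x\<in>X. elts x)" by blast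
  obtain p where p: "elts p = {x, y}" using pairing[of x y] by blast
  obtain z where "elts z = (\<Union>y\<in>elts p. elts y)" using union[of p] by blast
  then show ?case using p y by (intro exI[of _ z]) simp
qed

lemma union_of_eqI: "elts z = (\<Union>x\<in>X. elts x) \<Longrightarrow> union_of X = z"
  unfolding union_of_def by (rule the_equality) (auto intro: extensionality)

lemma elts_union_of: "finite X \<Longrightarrow> elts (union_of X) = (\<Union>x\<in>X. elts x)"
  using ex_elts_Union_finite[of X] union_of_eqI[of _ X] by auto


section \<open>Disjoint families of nonempty sets\<close>

text \<open>Any single point \<open>x\<close> of \<open>f i\<close> decides whether \<open>i\<close> is in the index set, since no other
  member of the family contains \<open>x\<close>. All the comparisons of unions below rest on this.\<close>

lemma mem_UN_iff_disjoint:
  assumes "disjoint_family_on f I" "i \<in> I" "x \<in> f i" "A \<subseteq> I"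
  shows "x \<in> (\<Union>i\<in>A. f i) \<longleftrightarrow> i \<in> A"
proof
  assume "x \<in> (\<Union>i\<in>A. f i)"
  then obtain j where j: "j \<in> A" "x \<in> f j" by blast
  then have "f i \<inter> f j \<noteq> {}" using assms(3) by blast
  then have "i = j" using assms(1,2,4) j(1) unfolding disjoint_family_on_def by (meson subsetD)
  then show "i \<in> A" using j(1) by simp
qed (use assms(3) in blast)

lemma UN_mono_iff_disjoint:
  assumes "disjoint_family_on f I" "\<And>i. i \<in> I \<Longrightarrow> f i \<noteq> {}" "A \<subseteq> I" "B \<subseteq> I"
  shows "(\<Union>i\<in>A. f i) \<subseteq> (\<Union>i\<in>B. f i) \<longleftrightarrow> A \<subseteq> B"
proof
  assume sub: "(\<Union>i\<in>A. f i) \<subseteq> (\<Union>i\<in>B. f i)"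
  show "A \<subseteq> B"
  proof
    fix i assume i: "i \<in> A"
    then have "i \<in> I" using assms(3) by (rule subsetD[rotated])
    moreover obtain x where "x \<in> f i" using assms(2)[OF \<open>i \<in> I\<close>] by (meson ex_in_conv)
    moreover from this have "x \<in> (\<Union>i\<in>B. f i)" using sub i by (meson UN_I subsetD)
    ultimately show "i \<in> B" using mem_UN_iff_disjoint[OF assms(1) _ _ assms(4)] by simp
  qed
qed (rule UN_mono, auto)

lemma UN_eq_iff_disjoint:
  assumes "disjoint_family_on f I" "\<And>i. i \<in> I \<Longrightarrow> f i \<noteq> {}" "A \<subseteq> I" "B \<subseteq> I"
  shows "(\<Union>i\<in>A. f i) = (\<Union>i\<in>B. f i) \<longleftrightarrow> A = B"
  using UN_mono_iff_disjoint[OF assms] UN_mono_iff_disjoint[OF assms(1,2,4,3)]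
  by (simp only: set_eq_subset)

lemma UN_Int_disjoint:
  assumes "disjoint_family_on f I" "A \<subseteq> I" "B \<subseteq> I"
  shows "(\<Union>i\<in>A. f i) \<inter> (\<Union>i\<in>B. f i) = (\<Union>i\<in>A \<inter> B. f i)"
proof (rule set_eqI)
  fix x
  show "x \<in> (\<Union>i\<in>A. f i) \<inter> (\<Union>i\<in>B. f i) \<longleftrightarrow> x \<in> (\<Union>i\<in>A \<inter> B. f i)"
  proof (cases "\<exists>i\<in>A. x \<in> f i")
    case True
    then obtain i where "i \<in> I" "x \<in> f i" using assms(2) by (meson subsetD)
    note mem = mem_UN_iff_disjoint[OF assms(1) this]
    have "A \<inter> B \<subseteq> I" using assms(2) by auto
    then show ?thesis using mem[OF assms(2)] mem[OF assms(3)] mem[of "A \<inter> B"] by simp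
  qed auto
qed

lemma UN_Diff_disjoint:
  assumes "disjoint_family_on f I" "A \<subseteq> I" "B \<subseteq> I"
  shows "(\<Union>i\<in>A. f i) - (\<Union>i\<in>B. f i) = (\<Union>i\<in>A - B. f i)"
proof (rule set_eqI)
  fix x
  show "x \<in> (\<Union>i\<in>A. f i) - (\<Union>i\<in>B. f i) \<longleftrightarrow> x \<in> (\<Union>i\<in>A - B. f i)"
  proof (cases "\<exists>i\<in>A. x \<in> f i")
    case True
    then obtain i where "i \<in> I" "x \<in> f i" using assms(2) by (meson subsetD)
    note mem = mem_UN_iff_disjoint[OF assms(1) this]
    have "A - B \<subseteq> I" using assms(2) by auto
    then show ?thesis using mem[OF assms(2)] mem[OF assms(3)] mem[of "A - B"] by simp
  qed auto
qed


lemma UN_Boolean_iff_disjoint: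
  assumes "disjoint_family_on f I" "\<And>i. i \<in> I \<Longrightarrow> f i \<noteq> {}" "A \<subseteq> I" "B \<subseteq> I" "C \<subseteq> I"
  shows "(\<Union>i\<in>A. f i) = (\<Union>i\<in>B. f i) \<union> (\<Union>i\<in>C. f i) \<longleftrightarrow> A = B \<union> C"
    and "(\<Union>i\<in>A. f i) = (\<Union>i\<in>B. f i) \<inter> (\<Union>i\<in>C. f i) \<longleftrightarrow> A = B \<inter> C"
    and "(\<Union>i\<in>A. f i) = (\<Union>i\<in>B. f i) - (\<Union>i\<in>C. f i) \<longleftrightarrow> A = B - C"
proof -
  have "B \<union> C \<subseteq> I" "B \<inter> C \<subseteq> I" "B - C \<subseteq> I" using assms(4,5) by auto
  note eq = UN_eq_iff_disjoint[OF assms(1,2,3), OF _ this(1)]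
    UN_eq_iff_disjoint[OF assms(1,2,3), OF _ this(2)]
    UN_eq_iff_disjoint[OF assms(1,2,3), OF _ this(3)]
  show "(\<Union>i\<in>A. f i) = (\<Union>i\<in>B. f i) \<union> (\<Union>i\<in>C. f i) \<longleftrightarrow> A = B \<union> C"
    using eq(1) by (simp only: UN_Un)
  show "(\<Union>i\<in>A. f i) = (\<Union>i\<in>B. f i) \<inter> (\<Union>i\<in>C. f i) \<longleftrightarrow> A = B \<inter> C"
    using eq(2) by (simp only: UN_Int_disjoint[OF assms(1,4,5)])
  show "(\<Union>i\<in>A. f i) = (\<Union>i\<in>B. f i) - (\<Union>i\<in>C. f i) \<longleftrightarrow> A = B - C"
    using eq(3) by (simp only: UN_Diff_disjoint[OF assms(1,4,5)])
qed


section \<open>Blocks of a partition\<close>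

lemma set_partition_disjoint:
  assumes "set_partition \<Sigma>"
  shows "disjoint_family_on elts \<Sigma>"
proof (rule disjoint_image_disjoint_family_on)
  show "disjoint (elts ` \<Sigma>)" using assms unfolding set_partition_def by (rule partition_onD2)
qed (simp add: inj_on_def extensionality)

lemma set_partition_nonempty: "set_partition \<Sigma> \<Longrightarrow> p \<in> \<Sigma> \<Longrightarrow> elts p \<noteq> {}"
  unfolding set_partition_def by (drule partition_onD3) (metis imageI)

text \<open>The node of \<open>x\<close> consists of the blocks that meet \<open>x\<close>: they cover \<open>x\<close>, and adaptedness keeps
  them inside it. Disjointness makes this the only choice.\<close>

lemma parts_adapted:
  assumes "adapted_partition H \<Sigma>" and "x \<in> H"
  shows "parts \<Sigma> x \<subseteq> \<Sigma>" and "elts x = (\<Union>p\<in>parts \<Sigma> x. elts p)"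
proof -
  have cover: "(\<Union>p\<in>\<Sigma>. elts p) = (\<Union>x\<in>H. elts x)"
    using assms(1) unfolding adapted_partition_def
    by (elim conjE) (drule partition_onD1, simp)
  then have part: "set_partition \<Sigma>"
    using assms(1) unfolding adapted_partition_def set_partition_def by simp
  let ?P = "\<lambda>\<Gamma>. \<Gamma> \<subseteq> \<Sigma> \<and> elts x = (\<Union>p\<in>\<Gamma>. elts p)"
  have ex: "?P {p \<in> \<Sigma>. elts p \<inter> elts x \<noteq> {}}"
  proof -
    have inside: "elts p \<subseteq> elts x" if "p \<in> \<Sigma>" "elts p \<inter> elts x \<noteq> {}" for p
      using assms that unfolding adapted_partition_def by simp
    have "z \<in> (\<Union>p\<in>{p \<in> \<Sigma>. elts p \<inter> elts x \<noteq> {}}. elts p)" if z: "z \<in> elts x" for z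
    proof -
      have "z \<in> (\<Union>p\<in>\<Sigma>. elts p)" using z assms(2) unfolding cover by (meson UN_I)
      then obtain p where p: "p \<in> \<Sigma>" "z \<in> elts p" by (meson UN_E)
      then have "elts p \<inter> elts x \<noteq> {}" using z by (meson disjoint_iff)
      then show ?thesis using p by (intro UN_I[of p]) simp_all
    qed
    then show ?thesis by (intro conjI equalityI UN_least subsetI) (auto dest: subsetD[OF inside])
  qed
  have unique: "\<Gamma> = \<Delta>" if "?P \<Gamma>" "?P \<Delta>" for \<Gamma> \<Delta>
    using UN_eq_iff_disjoint[OF set_partition_disjoint[OF part] set_partition_nonempty[OF part],
        of \<Gamma> \<Delta>] that by simp
  have "?P (parts \<Sigma> x)"
    unfolding parts_def by (rule theI[of ?P, OF ex unique[OF _ ex]])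
  then show "parts \<Sigma> x \<subseteq> \<Sigma>" "elts x = (\<Union>p\<in>parts \<Sigma> x. elts p)" by blast+
qed


section \<open>Literals under replacement of blocks\<close>

fun boolean_literal :: "'v literal \<Rightarrow> bool" where
  "boolean_literal (Mem _ _) = False"
| "boolean_literal (NotMem _ _) = False"
| "boolean_literal (IsPow _ _) = False"
| "boolean_literal (IsEnum _ _ _) = False"
| "boolean_literal (IsFinite _) = False"
| "boolean_literal (NotFinite _) = False"
| "boolean_literal _ = True"

text \<open>The setting forgets formulas and boards: \<open>node v\<close> is the set of blocks making up \<open>M v\<close>, and
  the clauses of imitation enter only as hypotheses of the lemmas that use them.\<close>

locale block_replacement =
  fixes \<Sigma> \<Sigma>' :: "'a::set_universe set" and \<beta> :: "'a \<Rightarrow> 'a"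
    and V :: "'v set" and node :: "'v \<Rightarrow> 'a set" and M M' :: "'v \<Rightarrow> 'a"
  assumes finite_blocks: "finite \<Sigma>"
    and partition: "set_partition \<Sigma>"
    and partition': "set_partition \<Sigma>'"
    and bij: "bij_betw \<beta> \<Sigma> \<Sigma>'"
    and node_subset: "v \<in> V \<Longrightarrow> node v \<subseteq> \<Sigma>"
    and elts_M: "v \<in> V \<Longrightarrow> elts (M v) = (\<Union>p\<in>node v. elts p)"
    and M'_eq: "v \<in> V \<Longrightarrow> M' v = union_of (\<beta> ` node v)"
begin

lemma cover': "(\<Union>q\<in>\<Sigma>'. elts q) = (\<Union>p\<in>\<Sigma>. elts (\<beta> p))"
  using bij by (auto simp: bij_betw_def)

lemma disjoint': "disjoint_family_on (\<lambda>p. elts (\<beta> p)) \<Sigma>"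
  unfolding disjoint_family_on_def
proof (intro ballI impI)
  fix p q assume "p \<in> \<Sigma>" "q \<in> \<Sigma>" "p \<noteq> q"
  then have "\<beta> p \<in> \<Sigma>'" "\<beta> q \<in> \<Sigma>'" "\<beta> p \<noteq> \<beta> q"
    using bij by (auto simp: bij_betw_def inj_on_eq_iff)
  then show "elts (\<beta> p) \<inter> elts (\<beta> q) = {}"
    using set_partition_disjoint[OF partition'] by (simp add: disjoint_family_on_def)
qed

lemma nonempty': "p \<in> \<Sigma> \<Longrightarrow> elts (\<beta> p) \<noteq> {}"
  by (rule set_partition_nonempty[OF partition' bij_betw_apply[OF bij]])

lemma elts_M': "v \<in> V \<Longrightarrow> elts (M' v) = (\<Union>p\<in>node v. elts (\<beta> p))"
  using elts_union_of[of "\<beta> ` node v"] M'_eq node_subset finite_subset[OF _ finite_blocks] by auto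

lemma M_eq: "v \<in> V \<Longrightarrow> M v = union_of (node v)"
  using union_of_eqI[OF elts_M] by simp

lemma in_value_iff:
  assumes "p \<in> \<Sigma>" "x \<in> elts p" "v \<in> V"
  shows "x \<in> elts (M v) \<longleftrightarrow> p \<in> node v"
  using mem_UN_iff_disjoint[OF set_partition_disjoint[OF partition] assms(1,2)] assms(3)
  by (simp add: elts_M node_subset)

lemma in_value_iff':
  assumes "p \<in> \<Sigma>" "x \<in> elts (\<beta> p)" "v \<in> V"
  shows "x \<in> elts (M' v) \<longleftrightarrow> p \<in> node v"
  using mem_UN_iff_disjoint[OF disjoint' assms(1,2)] assms(3) by (simp add: elts_M' node_subset)

text \<open>In \<open>M\<close> and in \<open>M'\<close> the literal expresses the same relation between the nodes of its variables,
  because the blocks and their images are both disjoint and nonempty families over \<open>\<Sigma>\<close>.\<close>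

lemma sat_boolean_iff:
  assumes "boolean_literal l" "lit_vars l \<subseteq> V"
  shows "sat M' l \<longleftrightarrow> sat M l"
proof -
  note partition_rules = set_partition_disjoint[OF partition] set_partition_nonempty[OF partition]
  note rules = UN_Boolean_iff_disjoint[OF partition_rules] UN_eq_iff_disjoint[OF partition_rules]
    UN_mono_iff_disjoint[OF partition_rules]
  note rules' = UN_Boolean_iff_disjoint[OF disjoint' nonempty']
    UN_eq_iff_disjoint[OF disjoint' nonempty'] UN_mono_iff_disjoint[OF disjoint' nonempty']
  have eq_iff: "x = y \<longleftrightarrow> elts x = elts y" for x y :: 'a
    using extensionality[of x y] by metis
  show ?thesis
  proof (cases l)
    case (IsEmpty v)
    then show ?thesis
      using assms(2) rules(4)[of "node v" "{}"] rules'(4)[of "node v" "{}"]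
      by (simp add: elts_M elts_M' node_subset del: SUP_bot_conv)
  qed (use assms in \<open>simp_all add: eq_iff[of "M _"] eq_iff[of "M' _"] elts_M elts_M' node_subset
        rules rules' del: UN_simps\<close>)
qed

lemma value_eq_iff: "v \<in> V \<Longrightarrow> w \<in> V \<Longrightarrow> M' v = M' w \<longleftrightarrow> M v = M w"
  using sat_boolean_iff[of "Eq v w"] by simp

text \<open>The hypothesis is clause (2), applied to the node of \<open>v\<close> and the blocks in the node of \<open>w\<close>.\<close>

lemma member_iff:
  assumes "\<And>\<Gamma> \<sigma>. \<Gamma> \<subseteq> \<Sigma> \<Longrightarrow> \<sigma> \<in> \<Sigma> \<Longrightarrow>
      union_of (\<beta> ` \<Gamma>) \<in> elts (\<beta> \<sigma>) \<longleftrightarrow> union_of \<Gamma> \<in> elts \<sigma>"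
    and "v \<in> V" "w \<in> V"
  shows "M' v \<in> elts (M' w) \<longleftrightarrow> M v \<in> elts (M w)"
proof -
  have "union_of (\<beta> ` node v) \<in> elts (\<beta> p) \<longleftrightarrow> union_of (node v) \<in> elts p" if "p \<in> node w" for p
    using assms node_subset that by blast
  then show ?thesis
    using assms(2,3) by (simp add: elts_M elts_M' M_eq[of v] M'_eq[of v])
qed

text \<open>The hypothesis is clause (4'). Bijections between corresponding blocks glue to one between
  the unions, as the blocks are disjoint on both sides.\<close>

lemma elts_eqpoll:
  assumes "v \<in> V" "\<And>p. p \<in> node v \<Longrightarrow> elts (\<beta> p) \<approx> elts p"
  shows "elts (M' v) \<approx> elts (M v)"
proof -
  have "pairwise (\<lambda>p q. disjnt (f p) (f q)) (node v)" if "disjoint_family_on f \<Sigma>" for f :: "'a \<Rightarrow> 'a set"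
    using that node_subset[OF assms(1)] unfolding disjoint_family_on_def pairwise_def disjnt_def by blast
  then show ?thesis
    using assms UN_eqpoll_UN[of "node v" "\<lambda>p. elts (\<beta> p)" elts] disjoint'
      set_partition_disjoint[OF partition] by (simp add: elts_M elts_M')
qed

text \<open>Clause (2) alone would allow \<open>M' v\<close> to have members besides the \<open>M' w\<close>. Counting excludes them:
  since \<open>M'\<close> identifies the same variables as \<open>M\<close>, the \<open>M' w\<close> are as many as the members of \<open>M v\<close>,
  hence of the finite set \<open>M' v\<close>.\<close>

lemma enumeration_transfer:
  assumes "v \<in> V" "W \<subseteq> V" "finite W"
    and "elts (M v) = M ` W"
    and members: "\<And>w. w \<in> W \<Longrightarrow> M' w \<in> elts (M' v)"
    and "elts (M' v) \<approx> elts (M v)"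
  shows "elts (M' v) = M' ` W"
proof -
  have fin: "finite (elts (M v))" using assms(3,4) by simp
  then have fin': "finite (elts (M' v))" using assms(6) eqpoll_finite_iff by blast
  \<comment> \<open>The correspondence of \<open>M w\<close> with \<open>M' w\<close> as a function on values: choose any variable with
    the given value under \<open>M\<close>.\<close>
  have "bij_betw (\<lambda>x. M' (inv_into W M x)) (M ` W) (M' ` W)"
  proof -
    have inv: "inv_into W M x \<in> W" "M (inv_into W M x) = x" if "x \<in> M ` W" for x
      using that by (auto intro: inv_into_into f_inv_into_f)
    then have "M' (inv_into W M (M x)) = M' x" if "x \<in> W" for x
      using that value_eq_iff assms(2) by blast
    moreover have "inj_on (\<lambda>x. M' (inv_into W M x)) (M ` W)"
      by (rule inj_onI) (metis inv value_eq_iff assms(2) subsetD)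
    ultimately show ?thesis
      unfolding bij_betw_def by (simp add: image_image)
  qed
  then have "card (M' ` W) = card (M ` W)" by (metis bij_betw_same_card)
  then have "card (M' ` W) = card (elts (M' v))"
    using assms(4,6) fin fin' eqpoll_iff_card by metis
  then show ?thesis
    using card_subset_eq[OF fin'] members by (metis image_subsetI)
qed

text \<open>For a set \<open>y\<close> in a block \<open>\<beta> \<sigma>\<close>, let \<open>\<Gamma>\<close> be the node whose image blocks are those that \<open>y\<close> meets.
  Clause (1) provides an \<open>x\<close> in \<open>\<sigma>\<close> that is spread over \<open>\<Gamma>\<close> as \<open>y\<close> is over \<open>\<beta> ` \<Gamma>\<close>. Whether \<open>x\<close> is a
  subset of \<open>M w\<close>, and whether \<open>y\<close> is one of \<open>M' w\<close>, depends only on \<open>\<Gamma>\<close>; whether \<open>x\<close> is in \<open>M u\<close>, and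
  whether \<open>y\<close> is in \<open>M' u\<close>, depends only on \<open>\<sigma>\<close>. So the powerset relation passes from \<open>x\<close> to \<open>y\<close>.\<close>

lemma powerset_transfer:
  assumes clause1: "\<And>\<Gamma> \<sigma>. \<Gamma> \<subseteq> \<Sigma> \<Longrightarrow> \<sigma> \<in> \<Sigma> \<Longrightarrow>
      elts (\<beta> \<sigma>) \<inter> pow_star (\<beta> ` \<Gamma>) \<noteq> {} \<Longrightarrow> elts \<sigma> \<inter> pow_star \<Gamma> \<noteq> {}"
    and clause3: "\<And>\<Gamma>. \<Gamma> \<subseteq> node w \<Longrightarrow> pow_star (\<beta> ` \<Gamma>) \<subseteq> (\<Union>q\<in>\<Sigma>'. elts q)"
    and trans: "transitive_family \<Sigma>'"
    and vars: "u \<in> V" "w \<in> V"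
    and pow: "elts (M u) = {y. elts y \<subseteq> elts (M w)}"
  shows "elts (M' u) = {y. elts y \<subseteq> elts (M' w)}"
proof -
  define met where "met y = {p \<in> \<Sigma>. elts (\<beta> p) \<inter> elts y \<noteq> {}}" for y
  have met_sub: "met y \<subseteq> \<Sigma>" for y by (auto simp: met_def)
  have metI: "p \<in> met y" if "p \<in> \<Sigma>" "z \<in> elts (\<beta> p)" "z \<in> elts y" for p y z
    using that by (auto simp: met_def)
  have coverE: "\<exists>p\<in>\<Sigma>. z \<in> elts (\<beta> p)" if "elts y \<subseteq> (\<Union>q\<in>\<Sigma>'. elts q)" "z \<in> elts y" for y z
    using subsetD[OF that] unfolding cover' by simp
  have in_pow_star: "y \<in> pow_star (\<beta> ` met y)" if y: "elts y \<subseteq> (\<Union>q\<in>\<Sigma>'. elts q)" for y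
    unfolding pow_star_def
  proof (intro CollectI conjI subsetI)
    fix z assume "z \<in> elts y"
    then show "z \<in> (\<Union>q\<in>\<beta> ` met y. elts q)" using coverE[OF y] metI by force
  qed (auto simp: met_def)
  have sub_iff: "elts y \<subseteq> elts (M' w) \<longleftrightarrow> met y \<subseteq> node w"
    if y: "elts y \<subseteq> (\<Union>q\<in>\<Sigma>'. elts q)" for y
  proof
    assume sub: "elts y \<subseteq> elts (M' w)"
    show "met y \<subseteq> node w"
    proof
      fix p assume "p \<in> met y"
      then obtain z where "p \<in> \<Sigma>" "z \<in> elts (\<beta> p)" "z \<in> elts y" by (auto simp: met_def)
      then show "p \<in> node w" using in_value_iff'[of p z w] vars(2) sub by auto
    qed
  next
    assume sub: "met y \<subseteq> node w"
    show "elts y \<subseteq> elts (M' w)"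
    proof
      fix z assume z: "z \<in> elts y"
      then obtain p where "p \<in> \<Sigma>" "z \<in> elts (\<beta> p)" using coverE[OF y] by auto
      then show "z \<in> elts (M' w)" using in_value_iff'[of p z w] vars(2) sub metI z by auto
    qed
  qed
  \<comment> \<open>One member of \<open>\<sigma>\<close> in \<open>pow_star \<Gamma>\<close> decides for the whole block: \<open>\<sigma>\<close> is inside \<open>M u\<close> or
    disjoint from it, and that member meets every block of \<open>\<Gamma>\<close>.\<close>
  have node_iff: "\<sigma> \<in> node u \<longleftrightarrow> \<Gamma> \<subseteq> node w"
    if "\<Gamma> \<subseteq> \<Sigma>" "\<sigma> \<in> \<Sigma>" and meets: "elts \<sigma> \<inter> pow_star \<Gamma> \<noteq> {}" for \<sigma> \<Gamma>
  proof -
    obtain x where x: "x \<in> elts \<sigma>" "x \<in> pow_star \<Gamma>" using meets by (meson disjoint_iff)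
    have "\<sigma> \<in> node u \<longleftrightarrow> elts x \<subseteq> elts (M w)"
      using in_value_iff[OF that(2) x(1) vars(1)] pow by simp
    also have "\<dots> \<longleftrightarrow> \<Gamma> \<subseteq> node w"
    proof
      assume sub: "elts x \<subseteq> elts (M w)"
      show "\<Gamma> \<subseteq> node w"
      proof
        fix p assume p: "p \<in> \<Gamma>"
        then obtain z where "z \<in> elts x" "z \<in> elts p"
          using x(2) unfolding pow_star_def by (auto simp: disjoint_iff)
        then show "p \<in> node w"
          using in_value_iff[of p z w] vars(2) subsetD[OF sub] subsetD[OF that(1) p] by simp
      qed
    next
      assume "\<Gamma> \<subseteq> node w"
      then show "elts x \<subseteq> elts (M w)"
        using x(2) elts_M[OF vars(2)] unfolding pow_star_def by blast
    qed
    finally show ?thesis .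
  qed
  have key: "y \<in> elts (M' u) \<longleftrightarrow> elts y \<subseteq> elts (M' w)"
    if y: "y \<in> elts (\<beta> \<sigma>)" "\<sigma> \<in> \<Sigma>" "elts y \<subseteq> (\<Union>q\<in>\<Sigma>'. elts q)" for y \<sigma>
  proof -
    have "elts \<sigma> \<inter> pow_star (met y) \<noteq> {}"
      using clause1[OF met_sub y(2)] in_pow_star[OF y(3)] y(1) by (meson disjoint_iff)
    then show ?thesis
      using node_iff[OF met_sub y(2)] in_value_iff'[OF y(2,1) vars(1)] sub_iff[OF y(3)] by simp
  qed
  show ?thesis
  proof (intro set_eqI iffI CollectI)
    fix y assume y: "y \<in> elts (M' u)"
    then obtain \<sigma> where \<sigma>: "\<sigma> \<in> \<Sigma>" "y \<in> elts (\<beta> \<sigma>)"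
      using elts_M'[OF vars(1)] node_subset[OF vars(1)] by auto
    then have "elts y \<subseteq> (\<Union>q\<in>\<Sigma>'. elts q)"
      using trans unfolding transitive_family_def cover' by auto
    then show "elts y \<subseteq> elts (M' w)" using key[OF \<sigma>(2,1)] y by simp
  next
    fix y assume "y \<in> {y. elts y \<subseteq> elts (M' w)}"
    then have y: "elts y \<subseteq> elts (M' w)" by simp
    then have cov: "elts y \<subseteq> (\<Union>q\<in>\<Sigma>'. elts q)"
      using elts_M'[OF vars(2)] node_subset[OF vars(2)] unfolding cover' by (auto 0 4)
    then have "y \<in> (\<Union>q\<in>\<Sigma>'. elts q)"
      using subsetD[OF clause3 in_pow_star] sub_iff y by simp
    then obtain \<sigma> where "\<sigma> \<in> \<Sigma>" "y \<in> elts (\<beta> \<sigma>)" unfolding cover' by auto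
    then show "y \<in> elts (M' u)" using key cov y by simp
  qed
qed

end


section \<open>Transfer for the canonical board\<close>

text \<open>Closure under subsets puts every node below that of \<open>w\<close> under clause (3), in particular the
  nodes met by the various subsets of \<open>M' w\<close>.\<close>

lemma canonical_pnodes_subset:
  assumes "IsPow u w \<in> literals \<Phi>" "\<Gamma> \<subseteq> parts \<Sigma> (M w)"
  shows "\<Gamma> \<in> pnodes (canonical_board M \<Phi> \<Sigma>)"
  using assms unfolding canonical_board_def by auto

lemma canonical_red:
  assumes "IsEnum v w ws \<in> literals \<Phi> \<or> IsFinite v \<in> literals \<Phi>"
  shows "parts \<Sigma> (M v) \<subseteq> red (canonical_board M \<Phi> \<Sigma>)"
  using assms unfolding canonical_board_def by auto

theorem corollary15:
  fixes \<Phi> :: "'v mlsspf"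
    and M M' :: "'v \<Rightarrow> 'a::set_universe"
    and \<Sigma> \<Sigma>' :: "'a set"
    and \<beta> :: "'a \<Rightarrow> 'a"
  assumes "is_venn_partition (M ` vars \<Phi>) \<Sigma>"
    and "colored_transitive_board \<Sigma> (canonical_board M \<Phi> \<Sigma>)"
    and "set_partition \<Sigma>'"
    and "\<And>u w. IsPow u w \<in> literals \<Phi> \<Longrightarrow> transitive_family \<Sigma>'"
    and "bij_betw \<beta> \<Sigma> \<Sigma>'"
    and "imitates_upwards \<Sigma> (canonical_board M \<Phi> \<Sigma>) \<Sigma>' \<beta>"
    and "\<And>v. v \<in> vars \<Phi> \<Longrightarrow> M' v = union_of (\<beta> ` parts \<Sigma> (M v))"
  shows "\<forall>l \<in> literals_minus \<Phi> \<union> {l \<in> literals \<Phi>. is_IsFinite l}.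
           (sat M l \<longrightarrow> sat M' l) \<and>
           (sat M' l \<and> \<not> is_IsPow l \<and> \<not> is_IsEnum l \<longrightarrow> sat M l)"
proof
  fix l assume l: "l \<in> literals_minus \<Phi> \<union> {l \<in> literals \<Phi>. is_IsFinite l}"
  then have lit: "l \<in> literals \<Phi>" and not_NotFinite: "\<not> is_NotFinite l"
    by (auto simp: literals_minus_def is_IsFinite_def)
  have vars: "lit_vars l \<subseteq> vars \<Phi>" using lit by (auto simp: vars_def)
  have adapted: "adapted_partition (M ` vars \<Phi>) \<Sigma>"
    using assms(1) by (simp add: is_venn_partition_def)
  interpret block_replacement \<Sigma> \<Sigma>' \<beta> "vars \<Phi>" "\<lambda>v. parts \<Sigma> (M v)" M M'
    using assms(2,3,5,7) parts_adapted[OF adapted]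
    by unfold_locales (auto simp: colored_transitive_board_def)
  note imitation = assms(6)[unfolded imitates_upwards_def, rule_format]
  have member: "M' v \<in> elts (M' w) \<longleftrightarrow> M v \<in> elts (M w)" if "v \<in> vars \<Phi>" "w \<in> vars \<Phi>" for v w
    using member_iff imitation that by blast
  have red_eqpoll: "elts (M' v) \<approx> elts (M v)"
    if "v \<in> vars \<Phi>" "IsEnum v w ws \<in> literals \<Phi> \<or> IsFinite v \<in> literals \<Phi>" for v w ws
  proof (rule elts_eqpoll[OF that(1)])
    fix p assume "p \<in> parts \<Sigma> (M v)"
    then show "elts (\<beta> p) \<approx> elts p"
      using imitation[of "{}" p] canonical_red[OF that(2), of \<Sigma> M] node_subset[OF that(1)] by blast
  qed
  consider "boolean_literal l" | v w where "l = Mem v w \<or> l = NotMem v w"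
    | u w where "l = IsPow u w" | v w ws where "l = IsEnum v w ws" | v where "l = IsFinite v"
    using not_NotFinite by (cases l) auto
  then show "(sat M l \<longrightarrow> sat M' l) \<and>
      (sat M' l \<and> \<not> is_IsPow l \<and> \<not> is_IsEnum l \<longrightarrow> sat M l)"
  proof cases
    case 1
    then show ?thesis using sat_boolean_iff vars by blast
  next
    case 2
    then show ?thesis using member vars by auto
  next
    case 3
    have "elts (M' u) = {y. elts y \<subseteq> elts (M' w)}" if "elts (M u) = {y. elts y \<subseteq> elts (M w)}"
    proof (rule powerset_transfer[OF _ _ _ _ _ that])
      show "transitive_family \<Sigma>'" using assms(4) lit 3 by blast
      show "u \<in> vars \<Phi>" "w \<in> vars \<Phi>" using vars 3 by auto
      show "pow_star (\<beta> ` \<Gamma>) \<subseteq> (\<Union>q\<in>\<Sigma>'. elts q)" if "\<Gamma> \<subseteq> parts \<Sigma> (M w)" for \<Gamma>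
      proof -
        \<comment> \<open>Every clause of imitation is stated for a block \<open>\<sigma>\<close>; here one exists because
          \<open>M w \<in> M u\<close>.\<close>
        have "M w \<in> elts (M u)" using \<open>elts (M u) = _\<close> by simp
        then obtain \<sigma> where "\<sigma> \<in> \<Sigma>" using elts_M[of u] node_subset[of u] vars 3 by auto
        moreover have "\<Gamma> \<subseteq> \<Sigma>" using that node_subset[of w] vars 3 by auto
        ultimately show ?thesis
          using imitation[of \<Gamma> \<sigma>] canonical_pnodes_subset[of u w \<Phi> \<Gamma> \<Sigma> M] that lit 3 by simp
      qed
      show "elts \<sigma> \<inter> pow_star \<Gamma> \<noteq> {}"
        if "\<Gamma> \<subseteq> \<Sigma>" "\<sigma> \<in> \<Sigma>" "elts (\<beta> \<sigma>) \<inter> pow_star (\<beta> ` \<Gamma>) \<noteq> {}" for \<Gamma> \<sigma>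
        using imitation[OF that(1,2)] that(3) by blast
    qed
    then show ?thesis using 3 by simp
  next
    case 4
    have "elts (M' v) = M' ` set (w # ws)" if "elts (M v) = M ` set (w # ws)"
    proof (rule enumeration_transfer[OF _ _ _ that])
      show "v \<in> vars \<Phi>" "set (w # ws) \<subseteq> vars \<Phi>" using vars 4 by auto
      show "elts (M' v) \<approx> elts (M v)" using red_eqpoll lit vars 4 by auto
      show "M' x \<in> elts (M' v)" if "x \<in> set (w # ws)" for x
        using member[of x v] \<open>elts (M v) = M ` set (w # ws)\<close> that vars 4 by auto
    qed simp
    then show ?thesis using 4 by simp
  next
    case 5
    then show ?thesis using eqpoll_finite_iff[OF red_eqpoll[of v]] lit vars by auto
  qed
qed

end
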